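(* Let $A$ be a group with a normal subgroup $C$, and let $G = \{A * \overline{A};\ C=\overline{C}\}$ be the double of $A$ along $C$. Then $G$ embeds (as a subgroup) in $$D = (A/C * \overline{A/C}) \times A,$$ the direct product of $A$ with the ordinary free product of two copies of $A/C$. Similarly, the HNN extension $A*_C$ of $A$ by a stable letter $s$ commuting with $C$ embeds in $$D' = (A/C * \langle s\rangle)\times A,$$ the direct product of $A$ with the ordinary free product of $A/C$ with the infinite cyclic group $\langle s\rangle$ generated by $s$.
   Context: Double: given a group $A$ and a subgroup $C\le A$, let $\overline{A}$ be an isomorphic copy of $A$ via an isomorphism $\theta: A\to\overline{A}$, $a\mapsto\overline{a}$, and let $\overline{C}=\theta(C)$. The double of $A$ along $C$ is the amalgamated free product $\{A*\overline{A};\ C=\overline{C}\}$ in which each $c\in C$ is identified with $\overline{c}=\theta(c)\in\overline{C}$. HNN extension: $A*_C = \langle A, s \mid s^{-1}cs=c\ \text{ for all } c\in C\rangle$, obtained by adjoining to $A$ a new stable letter $s$ that commutes with every element of $C$. *)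

theory Defs
  imports "HOL-Algebra.Elementary_Groups"
begin

text \<open>
  Words are lists of letters from the disjoint union of the two carriers, so the two factors
  are automatically distinct copies, even when they are the same group. The free product is the
  set of words modulo the congruence generated by the multiplication tables of the factors.
\<close>

definition fp_words :: "('a, 'm) monoid_scheme \<Rightarrow> ('b, 'n) monoid_scheme \<Rightarrow> ('a + 'b) list set"
  where "fp_words G H = lists (carrier G <+> carrier H)"

inductive fp_eq :: "('a, 'm) monoid_scheme \<Rightarrow> ('b, 'n) monoid_scheme
    \<Rightarrow> ('a + 'b) list \<Rightarrow> ('a + 'b) list \<Rightarrow> bool"
  for G :: "('a, 'm) monoid_scheme" and H :: "('b, 'n) monoid_scheme" where
  refl: "w \<in> fp_words G H \<Longrightarrow> fp_eq G H w w"
| sym: "fp_eq G H v w \<Longrightarrow> fp_eq G H w v"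
| trans: "fp_eq G H u v \<Longrightarrow> fp_eq G H v w \<Longrightarrow> fp_eq G H u w"
| append: "fp_eq G H u u' \<Longrightarrow> fp_eq G H v v' \<Longrightarrow> fp_eq G H (u @ v) (u' @ v')"
| left_one: "fp_eq G H [Inl \<one>\<^bsub>G\<^esub>] []"
| left_mult: "x \<in> carrier G \<Longrightarrow> y \<in> carrier G \<Longrightarrow> fp_eq G H [Inl x, Inl y] [Inl (x \<otimes>\<^bsub>G\<^esub> y)]"
| right_one: "fp_eq G H [Inr \<one>\<^bsub>H\<^esub>] []"
| right_mult: "x \<in> carrier H \<Longrightarrow> y \<in> carrier H \<Longrightarrow> fp_eq G H [Inr x, Inr y] [Inr (x \<otimes>\<^bsub>H\<^esub> y)]"

definition fp_class :: "('a, 'm) monoid_scheme \<Rightarrow> ('b, 'n) monoid_scheme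
    \<Rightarrow> ('a + 'b) list \<Rightarrow> ('a + 'b) list set"
  where "fp_class G H w = {v. fp_eq G H w v}"

definition free_product :: "('a, 'm) monoid_scheme \<Rightarrow> ('b, 'n) monoid_scheme
    \<Rightarrow> ('a + 'b) list set monoid"
  where "free_product G H =
    \<lparr>carrier = fp_class G H ` fp_words G H,
     monoid.mult = (\<lambda>X Y. {w. \<exists>u\<in>X. \<exists>v\<in>Y. fp_eq G H (u @ v) w}),
     one = fp_class G H []\<rparr>"

definition fp_inl :: "('a, 'm) monoid_scheme \<Rightarrow> ('b, 'n) monoid_scheme \<Rightarrow> 'a \<Rightarrow> ('a + 'b) list set"
  where "fp_inl G H x = fp_class G H [Inl x]"

definition fp_inr :: "('a, 'm) monoid_scheme \<Rightarrow> ('b, 'n) monoid_scheme \<Rightarrow> 'b \<Rightarrow> ('a + 'b) list set"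
  where "fp_inr G H y = fp_class G H [Inr y]"

definition normal_closure :: "('a, 'm) monoid_scheme \<Rightarrow> 'a set \<Rightarrow> 'a set"
  where "normal_closure G R = \<Inter>{N. N \<lhd> G \<and> R \<subseteq> N}"

definition amalgamated_product :: "('a, 'm) monoid_scheme \<Rightarrow> 'a set \<Rightarrow> ('a \<Rightarrow> 'b)
    \<Rightarrow> ('b, 'n) monoid_scheme \<Rightarrow> ('a + 'b) list set set monoid"
  where "amalgamated_product G C \<theta> H =
    free_product G H Mod normal_closure (free_product G H)
      {fp_inl G H c \<otimes>\<^bsub>free_product G H\<^esub> inv\<^bsub>free_product G H\<^esub> (fp_inr G H (\<theta> c)) | c. c \<in> C}"

text \<open>The double of \<open>A\<close> along \<open>C\<close>, where \<open>\<theta>\<close> is an isomorphism from \<open>A\<close> onto the copy \<open>Abar\<close>.\<close>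

definition group_double :: "('a, 'm) monoid_scheme \<Rightarrow> 'a set \<Rightarrow> ('a \<Rightarrow> 'b)
    \<Rightarrow> ('b, 'n) monoid_scheme \<Rightarrow> ('a + 'b) list set set monoid"
  where "group_double A C \<theta> Abar = amalgamated_product A C \<theta> Abar"

text \<open>
  The infinite cyclic group generated by the stable letter \<open>s\<close> is the additive group of the
  integers, \<open>s\<close> being the integer 1.
\<close>

definition stable_letter :: "('a, 'm) monoid_scheme \<Rightarrow> ('a + int) list set"
  where "stable_letter A = fp_inr A integer_group 1"

definition centralizing_HNN :: "('a, 'm) monoid_scheme \<Rightarrow> 'a set \<Rightarrow> ('a + int) list set set monoid"
  where "centralizing_HNN A C =
    (let F = free_product A integer_group; s = stable_letter A in
      F Mod normal_closure F
        {inv\<^bsub>F\<^esub> s \<otimes>\<^bsub>F\<^esub> fp_inl A integer_group c \<otimes>\<^bsub>F\<^esub> s \<otimes>\<^bsub>F\<^esub> inv\<^bsub>F\<^esub> (fp_inl A integer_group c) | c. c \<in> C})"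

lemma fp_words_simps [simp]:
  "[] \<in> fp_words G H"
  "Inl x # w \<in> fp_words G H \<longleftrightarrow> x \<in> carrier G \<and> w \<in> fp_words G H"
  "Inr y # w \<in> fp_words G H \<longleftrightarrow> y \<in> carrier H \<and> w \<in> fp_words G H"
  "u @ v \<in> fp_words G H \<longleftrightarrow> u \<in> fp_words G H \<and> v \<in> fp_words G H"
  by (auto simp: fp_words_def)

lemma fp_eq_words:
  assumes "group G" "group H" "fp_eq G H v w"
  shows "v \<in> fp_words G H" "w \<in> fp_words G H"
proof -
  interpret G: group G by fact
  interpret H: group H by fact
  have "v \<in> fp_words G H \<and> w \<in> fp_words G H"
    using assms(3) by induction auto
  then show "v \<in> fp_words G H" "w \<in> fp_words G H" by auto
qed

lemma fp_class_eq_iff: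
  assumes "v \<in> fp_words G H" "w \<in> fp_words G H"
  shows "fp_class G H v = fp_class G H w \<longleftrightarrow> fp_eq G H v w"
  using assms unfolding fp_class_def by (blast intro: fp_eq.intros)

lemma fp_mult_class:
  assumes "v \<in> fp_words G H" "w \<in> fp_words G H"
  shows "fp_class G H v \<otimes>\<^bsub>free_product G H\<^esub> fp_class G H w = fp_class G H (v @ w)"
proof -
  have "(\<exists>a\<in>fp_class G H v. \<exists>b\<in>fp_class G H w. fp_eq G H (a @ b) x) \<longleftrightarrow> fp_eq G H (v @ w) x" for x
    using assms unfolding fp_class_def
    by (blast intro: fp_eq.refl fp_eq.sym fp_eq.append fp_eq.trans)
  then show ?thesis by (simp add: free_product_def fp_class_def)
qed

lemma fp_left_inverse:
  assumes "group G" "group H" "w \<in> fp_words G H"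
  shows "\<exists>v\<in>fp_words G H. fp_eq G H (v @ w) []"
proof -
  interpret G: group G by fact
  interpret H: group H by fact
  show ?thesis using assms(3)
  proof (induction w)
    case Nil
    show ?case by (rule bexI[of _ "[]"]) (auto intro: fp_eq.refl)
  next
    case (Cons l w)
    have w: "w \<in> fp_words G H" using Cons.prems by (auto simp: fp_words_def)
    obtain v where v: "v \<in> fp_words G H" "fp_eq G H (v @ w) []" using Cons.IH w by blast
    obtain l' where l': "[l'] \<in> fp_words G H" "fp_eq G H [l', l] []"
    proof (cases l)
      case (Inl x)
      then have x: "x \<in> carrier G" using Cons.prems by simp
      have "fp_eq G H [Inl (inv\<^bsub>G\<^esub> x), Inl x] [Inl \<one>\<^bsub>G\<^esub>]"
        using fp_eq.left_mult[of "inv\<^bsub>G\<^esub> x" G x H] x by simp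
      then show ?thesis using that[of "Inl (inv\<^bsub>G\<^esub> x)"] x Inl
        by (auto intro: fp_eq.trans fp_eq.left_one)
    next
      case (Inr x)
      then have x: "x \<in> carrier H" using Cons.prems by simp
      have "fp_eq G H [Inr (inv\<^bsub>H\<^esub> x), Inr x] [Inr \<one>\<^bsub>H\<^esub>]"
        using fp_eq.right_mult[of "inv\<^bsub>H\<^esub> x" H x G] x by simp
      then show ?thesis using that[of "Inr (inv\<^bsub>H\<^esub> x)"] x Inr
        by (auto intro: fp_eq.trans fp_eq.right_one)
    qed
    have "fp_eq G H ([l', l] @ w) ([] @ w)"
      using l'(2) w by (intro fp_eq.append fp_eq.refl)
    then have "fp_eq G H (v @ ([l', l] @ w)) (v @ w)"
      using v(1) by (auto intro: fp_eq.append fp_eq.refl)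
    then have "fp_eq G H ((v @ [l']) @ (l # w)) []" using v(2) by (auto intro: fp_eq.trans)
    moreover have "v @ [l'] \<in> fp_words G H" using v l' by simp
    ultimately show ?case by blast
  qed
qed

lemma group_free_product:
  assumes "group G" "group H"
  shows "group (free_product G H)"
proof (rule groupI)
  have carrier: "carrier (free_product G H) = fp_class G H ` fp_words G H"
    and one: "\<one>\<^bsub>free_product G H\<^esub> = fp_class G H []"
    by (simp_all add: free_product_def)
  show "\<one>\<^bsub>free_product G H\<^esub> \<in> carrier (free_product G H)"
    unfolding carrier one by simp
  fix X assume "X \<in> carrier (free_product G H)"
  then obtain u where u: "u \<in> fp_words G H" "X = fp_class G H u" unfolding carrier by blast
  show "\<one>\<^bsub>free_product G H\<^esub> \<otimes>\<^bsub>free_product G H\<^esub> X = X"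
    using u by (simp add: one fp_mult_class)
  obtain u' where u': "u' \<in> fp_words G H" "fp_eq G H (u' @ u) []"
    using fp_left_inverse[OF assms u(1)] by blast
  then have "fp_class G H u' \<otimes>\<^bsub>free_product G H\<^esub> X = \<one>\<^bsub>free_product G H\<^esub>"
    using u by (simp add: one fp_mult_class fp_class_eq_iff)
  then show "\<exists>Y\<in>carrier (free_product G H). Y \<otimes>\<^bsub>free_product G H\<^esub> X = \<one>\<^bsub>free_product G H\<^esub>"
    using u' unfolding carrier by blast
  fix Y assume "Y \<in> carrier (free_product G H)"
  then obtain v where v: "v \<in> fp_words G H" "Y = fp_class G H v" unfolding carrier by blast
  show "X \<otimes>\<^bsub>free_product G H\<^esub> Y \<in> carrier (free_product G H)"
    using u v by (simp add: carrier fp_mult_class)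
  fix Z assume "Z \<in> carrier (free_product G H)"
  then obtain w where w: "w \<in> fp_words G H" "Z = fp_class G H w" unfolding carrier by blast
  show "X \<otimes>\<^bsub>free_product G H\<^esub> Y \<otimes>\<^bsub>free_product G H\<^esub> Z
      = X \<otimes>\<^bsub>free_product G H\<^esub> (Y \<otimes>\<^bsub>free_product G H\<^esub> Z)"
    using u v w by (simp add: fp_mult_class)
qed

lemma fp_inl_hom: "fp_inl G H \<in> hom G (free_product G H)"
proof (rule homI)
  fix x y assume xy: "x \<in> carrier G" "y \<in> carrier G"
  show "fp_inl G H x \<in> carrier (free_product G H)"
    using xy by (simp add: fp_inl_def free_product_def)
  have "fp_class G H [Inl (x \<otimes>\<^bsub>G\<^esub> y)] = fp_class G H [Inl x, Inl y]"
    using xy fp_eq.left_mult[of x G y H]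
    by (auto simp: fp_class_def intro: fp_eq.trans fp_eq.sym)
  then show "fp_inl G H (x \<otimes>\<^bsub>G\<^esub> y) = fp_inl G H x \<otimes>\<^bsub>free_product G H\<^esub> fp_inl G H y"
    using xy by (simp add: fp_inl_def fp_mult_class)
qed

lemma fp_inr_hom: "fp_inr G H \<in> hom H (free_product G H)"
proof (rule homI)
  fix x y assume xy: "x \<in> carrier H" "y \<in> carrier H"
  show "fp_inr G H x \<in> carrier (free_product G H)"
    using xy by (simp add: fp_inr_def free_product_def)
  have "fp_class G H [Inr (x \<otimes>\<^bsub>H\<^esub> y)] = fp_class G H [Inr x, Inr y]"
    using xy fp_eq.right_mult[of x H y G]
    by (auto simp: fp_class_def intro: fp_eq.trans fp_eq.sym)
  then show "fp_inr G H (x \<otimes>\<^bsub>H\<^esub> y) = fp_inr G H x \<otimes>\<^bsub>free_product G H\<^esub> fp_inr G H y"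
    using xy by (simp add: fp_inr_def fp_mult_class)
qed

lemma normal_closure_normal:
  assumes "group G" "R \<subseteq> carrier G"
  shows "normal_closure G R \<lhd> G"
proof -
  interpret group G by fact
  let ?S = "{N. N \<lhd> G \<and> R \<subseteq> N}"
  have "carrier G \<lhd> G" by (rule normalI) (auto simp: subgroup_self coset_join2 coset_join3)
  then have ne: "?S \<noteq> {}" using assms(2) by blast
  have "subgroup (\<Inter>?S) G"
    using ne by (intro subgroups_Inter) (auto simp: normal_imp_subgroup)
  moreover have "x \<otimes>\<^bsub>G\<^esub> h \<otimes>\<^bsub>G\<^esub> inv\<^bsub>G\<^esub> x \<in> \<Inter>?S" if "x \<in> carrier G" "h \<in> \<Inter>?S" for x h
    using that by (auto simp: normal_inv_iff)
  ultimately show ?thesis unfolding normal_closure_def normal_inv_iff by blast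
qed

lemma group_amalgamated_product:
  assumes "group G" "group H" "C \<subseteq> carrier G" "\<theta> ` C \<subseteq> carrier H"
  shows "group (amalgamated_product G C \<theta> H)"
proof -
  interpret F: group "free_product G H" by (rule group_free_product) fact+
  show ?thesis unfolding amalgamated_product_def
    using assms hom_in_carrier[OF fp_inl_hom[of G H]] hom_in_carrier[OF fp_inr_hom[of G H]]
    by (intro normal.factorgroup_is_group normal_closure_normal F.is_group)
       (auto intro!: F.m_closed F.inv_closed)
qed

lemma group_centralizing_HNN:
  assumes "group A" "C \<subseteq> carrier A"
  shows "group (centralizing_HNN A C)"
proof -
  interpret F: group "free_product A integer_group"
    by (rule group_free_product) (use assms in auto)
  show ?thesis unfolding centralizing_HNN_def Let_def stable_letter_def
    using assms hom_in_carrier[OF fp_inl_hom[of A integer_group]]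
      hom_in_carrier[OF fp_inr_hom[of A integer_group]]
    by (intro normal.factorgroup_is_group normal_closure_normal F.is_group)
       (auto intro!: F.m_closed F.inv_closed)
qed

end

theory Submission
  imports Defs "HOL-Algebra.Zassenhaus"
begin

text \<open>
  The image of \<open>C\<close> in the double, or in the HNN extension, is a normal subgroup, and dividing it
  out leaves the free product \<open>A/C * Q\<close>, respectively \<open>A/C * \<langle>s\<rangle>\<close>. So the kernel of the map onto
  this free product is the image of \<open>C\<close>, on which the retraction onto \<open>A\<close> is injective.
\<close>

section \<open>Cancellation, commutation and products of subsets\<close>

text \<open>Once \<open>m_assoc\<close> has nested a product to the right, a letter and its inverse
  can stand next to each other with a tail behind them. These rules let the simplifier cancel such
  pairs.\<close>

lemma (in group) m_inv_cancel:
  assumes "x \<in> carrier G" "y \<in> carrier G"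
  shows "x \<otimes> (inv x \<otimes> y) = y" "inv x \<otimes> (x \<otimes> y) = y"
  using assms by (simp_all flip: m_assoc)

text \<open>For a negative exponent, \<open>x [^] k\<close> and its inverse are inserted around
  \<open>y\<close>, and the natural power is moved past \<open>y\<close>. This is used to pass from
  the stable letter to all its powers.\<close>

lemma (in group) int_pow_commute:
  fixes n :: int
  assumes "x \<in> carrier G" "y \<in> carrier G" "x \<otimes> y = y \<otimes> x"
  shows "x [^] n \<otimes> y = y \<otimes> x [^] n"
proof (cases n rule: int_cases2)
  case (nonneg k)
  then show ?thesis using assms by (simp add: int_pow_int group_commutes_pow)
next
  case (nonpos k)
  have "inv (x [^] k) \<otimes> y = inv (x [^] k) \<otimes> (y \<otimes> x [^] k) \<otimes> inv (x [^] k)"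
    using assms by (simp add: m_assoc)
  also have "\<dots> = inv (x [^] k) \<otimes> (x [^] k \<otimes> y) \<otimes> inv (x [^] k)"
    using assms by (simp add: group_commutes_pow)
  also have "\<dots> = y \<otimes> inv (x [^] k)" using assms by (simp add: m_inv_cancel)
  finally show ?thesis using nonpos assms by (simp add: int_pow_neg_int)
qed

text \<open>The left side of the assumed equation has the shape of the HNN relators, with
  \<open>y\<close> the stable letter and \<open>x\<close> an element of \<open>C\<close>.\<close>

lemma (in group) commute_if_commutator_one:
  assumes "x \<in> carrier G" "y \<in> carrier G" "inv y \<otimes> x \<otimes> y \<otimes> inv x = \<one>"
  shows "x \<otimes> y = y \<otimes> x"
proof -
  have "inv y \<otimes> x \<otimes> y = x" using inv_solve_right'[of \<one> "inv y \<otimes> x \<otimes> y" x] assms by simp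
  then show ?thesis using assms by (simp add: m_assoc inv_solve_left')
qed

lemma set_multI: "x \<in> H \<Longrightarrow> y \<in> K \<Longrightarrow> x \<otimes>\<^bsub>G\<^esub> y \<in> H <#>\<^bsub>G\<^esub> K"
  unfolding set_mult_def by blast

lemma (in group) mem_set_mult_right:
  assumes "subgroup H G" "x \<in> K" "x \<in> carrier G"
  shows "x \<in> H <#> K"
proof -
  have "\<one> \<otimes> x \<in> H <#> K" using assms by (intro set_multI subgroup.one_closed)
  then show ?thesis using assms by simp
qed

section \<open>Factoring homomorphisms and the universal property of the free product\<close>

text \<open>The kernel condition makes \<open>f\<close> constant on the fibres of the surjection
  \<open>p\<close>, so \<open>f\<close> composed with any set-theoretic section of \<open>p\<close>
  is the induced map. Keeping \<open>p\<close> abstract serves the projection onto A/C and the map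
  on the second factor alike.\<close>

lemma hom_factor:
  assumes "group A" "group B" "group K"
    and p: "p \<in> hom A B" "p ` carrier A = carrier B" and f: "f \<in> hom A K"
    and ker: "\<And>a. a \<in> carrier A \<Longrightarrow> p a = \<one>\<^bsub>B\<^esub> \<Longrightarrow> f a = \<one>\<^bsub>K\<^esub>"
  obtains g where "g \<in> hom B K" "\<And>a. a \<in> carrier A \<Longrightarrow> g (p a) = f a"
proof -
  interpret A: group A by fact
  interpret B: group B by fact
  interpret K: group K by fact
  interpret p: group_hom A B p by unfold_locales (rule p)
  interpret f: group_hom A K f by unfold_locales (rule f)
  define s where "s = inv_into (carrier A) p"
  have s: "s b \<in> carrier A" "p (s b) = b" if "b \<in> carrier B" for b
    using that p(2) unfolding s_def by (auto intro: inv_into_into f_inv_into_f)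
  have eq: "f a = f a'" if a: "a \<in> carrier A" "a' \<in> carrier A" "p a = p a'" for a a'
  proof -
    have "f (a \<otimes>\<^bsub>A\<^esub> inv\<^bsub>A\<^esub> a') = \<one>\<^bsub>K\<^esub>" using a by (intro ker) auto
    then show ?thesis using a
      by (metis A.inv_closed K.inv_equality K.inv_inv f.hom_closed f.hom_inv f.hom_mult)
  qed
  show thesis
  proof
    show "f \<circ> s \<in> hom B K"
    proof (rule homI)
      fix x y assume "x \<in> carrier B" "y \<in> carrier B"
      \<comment> \<open>The section \<open>s\<close> need not be multiplicative, but
        \<open>s (x y)\<close> and \<open>s x * s y\<close> lie in the same fibre of
        \<open>p\<close>.\<close>
      then have "f (s (x \<otimes>\<^bsub>B\<^esub> y)) = f (s x \<otimes>\<^bsub>A\<^esub> s y)" using s by (intro eq) auto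
      then show "(f \<circ> s) (x \<otimes>\<^bsub>B\<^esub> y) = (f \<circ> s) x \<otimes>\<^bsub>K\<^esub> (f \<circ> s) y"
        using s \<open>x \<in> carrier B\<close> \<open>y \<in> carrier B\<close> by simp
    qed (use s in auto)
    show "(f \<circ> s) (p a) = f a" if "a \<in> carrier A" for a
      using that s by (auto intro: eq)
  qed
qed

lemma free_product_carrier: "carrier (free_product G H) = fp_class G H ` fp_words G H"
  by (simp add: free_product_def)

text \<open>A word is evaluated in \<open>K\<close> letter by letter. The relations generating
  \<open>fp_eq\<close> hold in \<open>K\<close> because \<open>f\<close> and \<open>g\<close> are
  homomorphisms, so the value depends only on the class of the word.\<close>

lemma free_product_lift:
  assumes "group G" "group H" "group K" and f: "f \<in> hom G K" and g: "g \<in> hom H K"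
  obtains h where "h \<in> hom (free_product G H) K"
    "\<And>x. x \<in> carrier G \<Longrightarrow> h (fp_inl G H x) = f x"
    "\<And>y. y \<in> carrier H \<Longrightarrow> h (fp_inr G H y) = g y"
proof -
  interpret G: group G by fact
  interpret H: group H by fact
  interpret K: group K by fact
  interpret f: group_hom G K f by unfold_locales (rule f)
  interpret g: group_hom H K g by unfold_locales (rule g)
  define ev where "ev = (\<lambda>w. foldr (\<lambda>l k. case_sum f g l \<otimes>\<^bsub>K\<^esub> k) w \<one>\<^bsub>K\<^esub>)"
  have ev_simps: "ev [] = \<one>\<^bsub>K\<^esub>" "ev (l # w) = case_sum f g l \<otimes>\<^bsub>K\<^esub> ev w" for l w
    by (simp_all add: ev_def)
  have closed: "ev w \<in> carrier K" if "w \<in> fp_words G H" for w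
    using that by (induction w) (auto simp: ev_simps fp_words_def)
  have ev_append: "ev (v @ w) = ev v \<otimes>\<^bsub>K\<^esub> ev w" if "v \<in> fp_words G H" "w \<in> fp_words G H" for v w
    using that
  proof (induction v)
    case (Cons l v)
    then have "v \<in> fp_words G H" "case_sum f g l \<in> carrier K" by (auto simp: fp_words_def)
    with Cons show ?case by (simp add: ev_simps closed K.m_assoc)
  qed (simp add: ev_simps closed)
  have cong: "ev v = ev w" if "fp_eq G H v w" for v w
    using that
  proof induction
    case (append u u' v v')
    then show ?case
      using fp_eq_words[OF assms(1,2)] ev_append by metis
  qed (auto simp: ev_simps)
  \<comment> \<open>Any representative of the class will do, by \<open>cong\<close>.\<close>
  define h where "h = (\<lambda>X. ev (SOME w. w \<in> X))"
  have h: "h (fp_class G H w) = ev w" if "w \<in> fp_words G H" for w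
  proof -
    have "(SOME v. v \<in> fp_class G H w) \<in> fp_class G H w"
      using that by - (rule someI[of _ w], simp add: fp_class_def fp_eq.refl)
    then have "fp_eq G H w (SOME v. v \<in> fp_class G H w)" by (simp add: fp_class_def)
    from cong[OF this] show ?thesis by (simp add: h_def)
  qed
  show thesis
  proof
    show "h \<in> hom (free_product G H) K"
    proof (rule homI)
      fix X Y assume "X \<in> carrier (free_product G H)" "Y \<in> carrier (free_product G H)"
      then show "h (X \<otimes>\<^bsub>free_product G H\<^esub> Y) = h X \<otimes>\<^bsub>K\<^esub> h Y"
        by (auto simp: free_product_carrier fp_mult_class h ev_append)
    qed (auto simp: free_product_carrier h closed)
  qed (auto simp: fp_inl_def fp_inr_def h ev_simps)
qed

text \<open>Every element is a finite product of letters from the two factors. Peeling off the first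
  letter gives an induction on group elements that keeps words and classes out of the later
  proofs.\<close>

lemma free_product_induct [consumes 1, case_names one inl inr]:
  assumes "X \<in> carrier (free_product G H)"
    and "P \<one>\<^bsub>free_product G H\<^esub>"
    and "\<And>x X. x \<in> carrier G \<Longrightarrow> X \<in> carrier (free_product G H) \<Longrightarrow> P X
      \<Longrightarrow> P (fp_inl G H x \<otimes>\<^bsub>free_product G H\<^esub> X)"
    and "\<And>y X. y \<in> carrier H \<Longrightarrow> X \<in> carrier (free_product G H) \<Longrightarrow> P X
      \<Longrightarrow> P (fp_inr G H y \<otimes>\<^bsub>free_product G H\<^esub> X)"
  shows "P X"
proof -
  have "P (fp_class G H w)" if "w \<in> fp_words G H" for w
    using that
  proof (induction w)
    case Nil
    then show ?case using assms(2) by (simp add: free_product_def)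
  next
    case (Cons l w)
    have w: "w \<in> fp_words G H" "[l] \<in> fp_words G H" using Cons.prems by (auto simp: fp_words_def)
    then have "fp_class G H (l # w) = fp_class G H [l] \<otimes>\<^bsub>free_product G H\<^esub> fp_class G H w"
      by (simp add: fp_mult_class)
    with w Cons.IH show ?case
      using assms(3,4)[of _ "fp_class G H w"]
      by (cases l) (auto simp: free_product_carrier fp_inl_def fp_inr_def)
  qed
  then show ?thesis using assms(1) unfolding free_product_carrier by blast
qed

text \<open>This is the uniqueness half of the universal property: the images of the two factors
  generate the free product.\<close>

lemma free_product_hom_eqI:
  assumes "group G" "group H" "group K"
    and "h \<in> hom (free_product G H) K" "k \<in> hom (free_product G H) K"
    and "\<And>x. x \<in> carrier G \<Longrightarrow> h (fp_inl G H x) = k (fp_inl G H x)"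
    and "\<And>y. y \<in> carrier H \<Longrightarrow> h (fp_inr G H y) = k (fp_inr G H y)"
    and "X \<in> carrier (free_product G H)"
  shows "h X = k X"
proof -
  have F: "group (free_product G H)" by (rule group_free_product) fact+
  show ?thesis using assms(8)
    by (induction rule: free_product_induct)
       (use assms in \<open>auto simp: hom_mult[OF assms(4)] hom_mult[OF assms(5)] hom_one[OF _ F]
         hom_in_carrier[OF fp_inl_hom] hom_in_carrier[OF fp_inr_hom]\<close>)
qed

section \<open>Normal closures and the normality of the image of C modulo relators\<close>

lemma normal_closure_subset: "R \<subseteq> normal_closure G R"
  unfolding normal_closure_def by blast

lemma normal_closure_minimal: "N \<lhd> G \<Longrightarrow> R \<subseteq> N \<Longrightarrow> normal_closure G R \<subseteq> N"
  unfolding normal_closure_def by blast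

text \<open>It suffices to conjugate by generators. Conjugation by \<open>i a\<close> preserves the
  image of \<open>C\<close> because \<open>C\<close> is normal in \<open>A\<close>; for
  \<open>j b\<close> this depends on the relators in \<open>N\<close>, so \<open>conj\<close> is
  left to each application.\<close>

lemma normal_set_mult_image_fp_inl:
  fixes A :: "('a, 'm) monoid_scheme" and B :: "('b, 'n) monoid_scheme"
  defines "F \<equiv> free_product A B"
  defines "i \<equiv> fp_inl A B" and "j \<equiv> fp_inr A B"
  assumes "group A" "group B" "C \<lhd> A" "N \<lhd> F"
    and conj: "\<And>b c. b \<in> carrier B \<Longrightarrow> c \<in> C
      \<Longrightarrow> j b \<otimes>\<^bsub>F\<^esub> i c \<otimes>\<^bsub>F\<^esub> inv\<^bsub>F\<^esub> (j b) \<in> N <#>\<^bsub>F\<^esub> i ` C"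
  shows "(N <#>\<^bsub>F\<^esub> i ` C) \<lhd> F"
proof -
  interpret A: group A by fact
  interpret F: group F unfolding F_def by (rule group_free_product) fact+
  interpret C: normal C A by fact
  interpret N: normal N F by fact
  have i_hom: "i \<in> hom A F" unfolding i_def F_def by (rule fp_inl_hom)
  have j_hom: "j \<in> hom B F" unfolding j_def F_def by (rule fp_inr_hom)
  interpret i: group_hom A F i by unfold_locales (rule i_hom)
  let ?M = "N <#>\<^bsub>F\<^esub> i ` C"
  have sub: "subgroup ?M F"
    by (intro F.mult_norm_subgroup i.subgroup_img_is_subgroup C.subgroup_axioms N.normal_axioms)
  interpret M: subgroup ?M F by (rule sub)
  have NM: "n \<in> ?M" if "n \<in> N" for n
  proof -
    have "n = n \<otimes>\<^bsub>F\<^esub> i \<one>\<^bsub>A\<^esub>" using that by simp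
    then show ?thesis using that C.one_closed unfolding set_mult_def by blast
  qed
  have CM: "i c \<in> ?M" if "c \<in> C" for c
    using that by (intro F.mem_set_mult_right) (auto intro: N.subgroup_axioms)
  have conj_mult: "x \<otimes>\<^bsub>F\<^esub> (u \<otimes>\<^bsub>F\<^esub> v) \<otimes>\<^bsub>F\<^esub> inv\<^bsub>F\<^esub> x
      = (x \<otimes>\<^bsub>F\<^esub> u \<otimes>\<^bsub>F\<^esub> inv\<^bsub>F\<^esub> x) \<otimes>\<^bsub>F\<^esub> (x \<otimes>\<^bsub>F\<^esub> v \<otimes>\<^bsub>F\<^esub> inv\<^bsub>F\<^esub> x)"
    if "x \<in> carrier F" "u \<in> carrier F" "v \<in> carrier F" for x u v
    using that by (simp add: F.m_assoc F.m_inv_cancel)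
  \<comment> \<open>Conjugation is multiplicative and \<open>N\<close> is already normal, so only
    the factor \<open>i c\<close> of an element of the product has to be checked.\<close>
  have gen: "x \<otimes>\<^bsub>F\<^esub> m \<otimes>\<^bsub>F\<^esub> inv\<^bsub>F\<^esub> x \<in> ?M"
    if x: "x \<in> carrier F" and *: "\<And>c. c \<in> C \<Longrightarrow> x \<otimes>\<^bsub>F\<^esub> i c \<otimes>\<^bsub>F\<^esub> inv\<^bsub>F\<^esub> x \<in> ?M" and m: "m \<in> ?M" for x m
  proof -
    obtain n c where nc: "n \<in> N" "c \<in> C" "m = n \<otimes>\<^bsub>F\<^esub> i c"
      using m unfolding set_mult_def by auto
    have "x \<otimes>\<^bsub>F\<^esub> n \<otimes>\<^bsub>F\<^esub> inv\<^bsub>F\<^esub> x \<in> N" using N.inv_op_closed2 x nc by auto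
    then show ?thesis unfolding nc(3)
      using x nc by (subst conj_mult) (blast intro: NM * N.mem_carrier i.hom_closed C.mem_carrier)+
  qed
  \<comment> \<open>Conjugating by \<open>i a * X\<close> means conjugating by \<open>X\<close> and
    then by \<open>i a\<close>. The claim ranges over all \<open>m\<close> at once because the inner
    conjugate is a new element of \<open>?M\<close>.\<close>
  have "\<forall>m\<in>?M. x \<otimes>\<^bsub>F\<^esub> m \<otimes>\<^bsub>F\<^esub> inv\<^bsub>F\<^esub> x \<in> ?M" if x: "x \<in> carrier F" for x
    using x[unfolded F_def]
  proof (induction rule: free_product_induct)
    case one
    then show ?case unfolding F_def[symmetric] by simp
  next
    case (inl a X)
    note X = inl(2)[folded F_def]
    have ia: "i a \<in> carrier F" using inl by simp
    have "i a \<otimes>\<^bsub>F\<^esub> i c \<otimes>\<^bsub>F\<^esub> inv\<^bsub>F\<^esub> (i a) \<in> ?M" if "c \<in> C" for c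
    proof -
      have "i a \<otimes>\<^bsub>F\<^esub> i c \<otimes>\<^bsub>F\<^esub> inv\<^bsub>F\<^esub> (i a) = i (a \<otimes>\<^bsub>A\<^esub> c \<otimes>\<^bsub>A\<^esub> inv\<^bsub>A\<^esub> a)"
        using that inl by simp
      then show ?thesis using CM[OF C.inv_op_closed2[OF inl(1) that]] by simp
    qed
    from gen[OF ia this inl(3)[rule_format]] show ?case
      unfolding F_def[symmetric] i_def[symmetric]
      using X ia by (simp add: F.m_assoc F.inv_mult_group)
  next
    case (inr b X)
    note X = inr(2)[folded F_def]
    have jb: "j b \<in> carrier F" using inr hom_in_carrier[OF j_hom] by simp
    from gen[OF jb conj[OF inr(1)] inr(3)[rule_format]] show ?case
      unfolding F_def[symmetric] j_def[symmetric]
      using X jb by (simp add: F.m_assoc F.inv_mult_group)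
  qed
  then show ?thesis using sub unfolding F.normal_inv_iff by blast
qed

section \<open>A common embedding criterion\<close>

text \<open>The point is that \<open>h\<close> has kernel exactly \<open>N\<close>. One inclusion
  holds because \<open>h\<close> kills \<open>R\<close>; for the other, the first component of
  \<open>h\<close> detects membership in \<open>N <#> i\<close>
  C\<open>and the second is injective on\<close>i \<open>C\<close>. The second component on
  \<open>j b\<close> is left open since it is \<open>\<tau> b\<close> for the double and \<one> for
  the HNN extension.\<close>

lemma mon_Mod_normal_closure:
  fixes A :: "('a, 'm) monoid_scheme" and B :: "('b, 'n) monoid_scheme"
    and A' :: "('c, 'k) monoid_scheme" and B' :: "('d, 'l) monoid_scheme"
    and R :: "('a + 'b) list set set"
  defines "F \<equiv> free_product A B" and "P \<equiv> free_product A' B'"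
  defines "i \<equiv> fp_inl A B" and "j \<equiv> fp_inr A B"
  defines "N \<equiv> normal_closure F R"
  assumes gr: "group A" "group B" "group A'" "group B'"
    and p: "p \<in> hom A A'" "p ` carrier A = carrier A'" "kernel A A' p = C"
    and q: "q \<in> hom B B'" "q ` carrier B = carrier B'"
    and h: "h \<in> hom F (P \<times>\<times> A)"
      "\<And>a. a \<in> carrier A \<Longrightarrow> h (i a) = (fp_inl A' B' (p a), a)"
      "\<And>b. b \<in> carrier B \<Longrightarrow> fst (h (j b)) = fp_inr A' B' (q b)"
    and R: "R \<subseteq> carrier F" "\<And>x. x \<in> R \<Longrightarrow> h x = \<one>\<^bsub>P \<times>\<times> A\<^esub>"
    and conj: "\<And>b c. b \<in> carrier B \<Longrightarrow> c \<in> C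
      \<Longrightarrow> j b \<otimes>\<^bsub>F\<^esub> i c \<otimes>\<^bsub>F\<^esub> inv\<^bsub>F\<^esub> (j b) \<in> N <#>\<^bsub>F\<^esub> i ` C"
    and kerq: "\<And>b. b \<in> carrier B \<Longrightarrow> q b = \<one>\<^bsub>B'\<^esub> \<Longrightarrow> j b \<in> N <#>\<^bsub>F\<^esub> i ` C"
  shows "(\<lambda>X. the_elem (h ` X)) \<in> mon (F Mod N) (P \<times>\<times> A)"
proof -
  interpret A: group A by fact
  interpret B: group B by fact
  interpret F: group F unfolding F_def by (rule group_free_product) fact+
  interpret P: group P unfolding P_def by (rule group_free_product) fact+
  interpret PA: group "P \<times>\<times> A" by (rule DirProd_group) unfold_locales
  interpret h: group_hom F "P \<times>\<times> A" h by unfold_locales (rule h)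
  interpret p: group_hom A A' p using gr p by (simp add: group_hom_def group_hom_axioms_def)
  have i_hom: "i \<in> hom A F" unfolding i_def F_def by (rule fp_inl_hom)
  have j_hom: "j \<in> hom B F" unfolding j_def F_def by (rule fp_inr_hom)
  have C: "C \<lhd> A" using p.normal_kernel p(3) by simp
  interpret C: normal C A by fact
  have N: "N \<lhd> F" unfolding N_def by (rule normal_closure_normal) (unfold_locales, rule R)
  interpret N: normal N F by fact
  define M where "M = N <#>\<^bsub>F\<^esub> i ` C"
  have M: "M \<lhd> F" unfolding M_def F_def i_def
    using gr C N conj by (intro normal_set_mult_image_fp_inl) (simp_all add: F_def i_def j_def)
  interpret M: normal M F by fact
  have CM: "i c \<in> M" if "c \<in> C" for c
    unfolding M_def using that hom_in_carrier[OF i_hom]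
    by (intro F.mem_set_mult_right) (auto intro: N.subgroup_axioms)
  interpret FM: group "F Mod M" by (rule M.factorgroup_is_group)
  have can: "(#>\<^bsub>F\<^esub>) M \<in> hom F (F Mod M)" by (rule M.r_coset_hom_Mod)
  have one_iff: "M #>\<^bsub>F\<^esub> x = \<one>\<^bsub>F Mod M\<^esub> \<longleftrightarrow> x \<in> M" if "x \<in> carrier F" for x
    using that by (metis F.coset_join1 F.coset_join2 M.subgroup_axioms one_FactGroup)
  \<comment> \<open>The map from \<open>A\<close> to \<open>F Mod M\<close> kills \<open>C\<close>,
    the kernel of \<open>p\<close>, and hence descends to \<open>A'\<close>. The same argument with
    \<open>kerq\<close> gives \<open>q'\<close> on \<open>B'\<close>.\<close>
  obtain p' where p': "p' \<in> hom A' (F Mod M)" "\<And>a. a \<in> carrier A \<Longrightarrow> p' (p a) = M #>\<^bsub>F\<^esub> i a"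
  proof (rule hom_factor[OF gr(1,3) FM.is_group p(1,2) hom_compose[OF i_hom can]])
    fix a assume "a \<in> carrier A" "p a = \<one>\<^bsub>A'\<^esub>"
    then have "a \<in> C" using p(3) by (auto simp: kernel_def)
    then show "((#>\<^bsub>F\<^esub>) M \<circ> i) a = \<one>\<^bsub>F Mod M\<^esub>" using CM one_iff M.subset by auto
  qed auto
  obtain q' where q': "q' \<in> hom B' (F Mod M)" "\<And>b. b \<in> carrier B \<Longrightarrow> q' (q b) = M #>\<^bsub>F\<^esub> j b"
  proof (rule hom_factor[OF gr(2,4) FM.is_group q(1,2) hom_compose[OF j_hom can]])
    fix b assume "b \<in> carrier B" "q b = \<one>\<^bsub>B'\<^esub>"
    then show "((#>\<^bsub>F\<^esub>) M \<circ> j) b = \<one>\<^bsub>F Mod M\<^esub>"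
      using kerq one_iff M.subset unfolding M_def by auto
  qed auto
  \<comment> \<open>Together \<open>p'\<close> and \<open>q'\<close> define a map from
    \<open>P\<close> back to \<open>F Mod M\<close>, through which the triviality of
    \<open>fst (h X)\<close> will be read as \<open>X \<in> M\<close>.\<close>
  obtain k where k: "k \<in> hom P (F Mod M)"
    "\<And>x. x \<in> carrier A' \<Longrightarrow> k (fp_inl A' B' x) = p' x"
    "\<And>y. y \<in> carrier B' \<Longrightarrow> k (fp_inr A' B' y) = q' y"
    using free_product_lift[OF gr(3,4) FM.is_group p'(1) q'(1)] unfolding P_def by blast
  have fst_h: "fst \<circ> h \<in> hom F P"
    by (rule hom_compose[OF h(1)]) (auto intro!: homI)
  \<comment> \<open>Both sides are homomorphisms in \<open>X\<close> on the free product, so they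
    are compared on the letters of the two factors.\<close>
  have k_h: "k (fst (h X)) = M #>\<^bsub>F\<^esub> X" if X: "X \<in> carrier F" for X
  proof -
    have "(k \<circ> (fst \<circ> h)) X = M #>\<^bsub>free_product A B\<^esub> X"
      using gr(1,2) FM.is_group[unfolded F_def] hom_compose[OF fst_h k(1), unfolded F_def] can[unfolded F_def]
    proof (rule free_product_hom_eqI[where X = X])
      fix x assume x: "x \<in> carrier A"
      show "(k \<circ> (fst \<circ> h)) (fp_inl A B x) = M #>\<^bsub>free_product A B\<^esub> fp_inl A B x"
        using x h(2) k(2) p'(2) by (simp add: i_def F_def)
    next
      fix y assume y: "y \<in> carrier B"
      show "(k \<circ> (fst \<circ> h)) (fp_inr A B y) = M #>\<^bsub>free_product A B\<^esub> fp_inr A B y"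
        using y h(3) k(3) q'(2) hom_in_carrier[OF q(1)] by (simp add: j_def F_def)
    qed (use X F_def in auto)
    then show ?thesis by (simp add: F_def)
  qed
  have N_ker: "N \<subseteq> kernel F (P \<times>\<times> A) h"
    unfolding N_def using R by (intro normal_closure_minimal h.normal_kernel) (auto simp: kernel_def)
  have "X \<in> N" if X: "X \<in> kernel F (P \<times>\<times> A) h" for X
  proof -
    have XF: "X \<in> carrier F" and hX: "h X = (\<one>\<^bsub>P\<^esub>, \<one>\<^bsub>A\<^esub>)" using X by (auto simp: kernel_def)
    have "M #>\<^bsub>F\<^esub> X = \<one>\<^bsub>F Mod M\<^esub>"
      using k_h[OF XF] hX hom_one[OF k(1) P.is_group FM.is_group] by simp
    then have "X \<in> M" using one_iff XF by simp
    then obtain n c where nc: "n \<in> N" "c \<in> C" "X = n \<otimes>\<^bsub>F\<^esub> i c"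
      unfolding M_def set_mult_def by auto
    have ic: "i c \<in> carrier F" using nc hom_in_carrier[OF i_hom] by simp
    have "h n = (\<one>\<^bsub>P\<^esub>, \<one>\<^bsub>A\<^esub>)" using N_ker nc by (auto simp: kernel_def)
    moreover have "fst (h (i c)) \<in> carrier P" using h.hom_closed[OF ic] by (cases "h (i c)") auto
    \<comment> \<open>As \<open>h\<close> kills \<open>n\<close>, only \<open>i c\<close>
      contributes; its second component is \<open>c\<close> itself, which forces \<open>c\<close> to
      be trivial and \<open>X\<close> to lie in \<open>N\<close>.\<close>
    ultimately have "h X = h (i c)" using nc ic h(2)[of c] by simp
    then have "c = \<one>\<^bsub>A\<^esub>" using hX h(2)[of c] nc by simp
    then show ?thesis using nc hom_one[OF i_hom A.is_group F.is_group] by simp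
  qed
  with N_ker have "kernel F (P \<times>\<times> A) h = N" by blast
  \<comment> \<open>With the kernel identified as \<open>N\<close>, this is the injectivity part of
    the first isomorphism theorem.\<close>
  then show ?thesis using h.FactGroup_hom h.FactGroup_inj_on by (simp add: mon_def)
qed

section \<open>The projection onto a quotient group\<close>

lemma kernel_r_coset:
  assumes "C \<lhd> A"
  shows "kernel A (A Mod C) ((#>\<^bsub>A\<^esub>) C) = C"
proof -
  interpret C: normal C A by fact
  have "C #>\<^bsub>A\<^esub> x = C \<longleftrightarrow> x \<in> C" if "x \<in> carrier A" for x
    using that C.coset_join1 C.coset_join2 C.subgroup_axioms by metis
  then show ?thesis using C.subset by (auto simp: kernel_def)
qed

lemma image_r_coset: "(#>\<^bsub>A\<^esub>) C ` carrier A = carrier (A Mod C)"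
  by (auto simp: FactGroup_def RCOSETS_def)

section \<open>The embedding of the double\<close>

text \<open>The map sends \<open>a\<close> to (aC, a) and a letter \<open>b\<close> of the copy to
  its class in \<open>Q\<close> paired with \<open>\<tau> b\<close>. On \<open>c\<close> and
  \<open>\<theta> c\<close> with \<open>c\<close> in \<open>C\<close> both give (1, c), so the
  relators die. The group \<open>Q\<close> plays the second copy of A/C.\<close>

lemma group_double_mon:
  fixes A :: "('a, 'm) monoid_scheme" and Abar :: "('b, 'n) monoid_scheme"
    and Q :: "('q, 'k) monoid_scheme"
  assumes "group A" "C \<lhd> A" "group Abar" and \<theta>: "\<theta> \<in> iso A Abar"
    and "group Q" and \<psi>: "\<psi> \<in> iso (A Mod C) Q"
  shows "\<exists>f. f \<in> mon (group_double A C \<theta> Abar) (free_product (A Mod C) Q \<times>\<times> A)"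
proof -
  interpret A: group A by fact
  interpret B: group Abar by fact
  interpret C: normal C A by fact
  interpret Q: group Q by fact
  interpret AC: group "A Mod C" by (rule C.factorgroup_is_group)
  define F where "F = free_product A Abar"
  define P where "P = free_product (A Mod C) Q"
  interpret F: group F unfolding F_def by (rule group_free_product) fact+
  interpret P: group P unfolding P_def by (rule group_free_product) unfold_locales
  interpret PA: group "P \<times>\<times> A" by (rule DirProd_group) unfold_locales
  define i where "i = fp_inl A Abar"
  define j where "j = fp_inr A Abar"
  have i_hom: "i \<in> hom A F" unfolding i_def F_def by (rule fp_inl_hom)
  have j_hom: "j \<in> hom Abar F" unfolding j_def F_def by (rule fp_inr_hom)
  interpret i: group_hom A F i by unfold_locales (rule i_hom)
  interpret j: group_hom Abar F j by unfold_locales (rule j_hom)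
  define R where "R = {i c \<otimes>\<^bsub>F\<^esub> inv\<^bsub>F\<^esub> (j (\<theta> c)) | c. c \<in> C}"
  define N where "N = normal_closure F R"
  \<comment> \<open>Folding the copy back by \<open>\<tau>\<close> gives the retraction of the
    double onto \<open>A\<close>, the second component of the embedding.\<close>
  define \<tau> where "\<tau> = inv_into (carrier A) \<theta>"
  define p where "p = (#>\<^bsub>A\<^esub>) C"
  define q where "q = \<psi> \<circ> (p \<circ> \<tau>)"
  have \<theta>_closed: "\<theta> a \<in> carrier Abar" if "a \<in> carrier A" for a
    using \<theta> that by (auto simp: iso_def hom_def)
  interpret \<theta>: group_hom A Abar \<theta> using \<theta> by unfold_locales (simp add: iso_def)
  have \<tau>: "\<tau> \<in> iso Abar A" unfolding \<tau>_def by (rule A.iso_set_sym) fact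
  have \<tau>_\<theta>: "\<tau> (\<theta> a) = a" if "a \<in> carrier A" for a
    using \<theta> that by (auto simp: \<tau>_def iso_def bij_betw_def)
  have \<theta>_\<tau>: "\<theta> (\<tau> b) = b" if "b \<in> carrier Abar" for b
    using \<theta> that by (auto simp: \<tau>_def iso_def bij_betw_def intro: f_inv_into_f)
  have \<tau>_closed: "\<tau> b \<in> carrier A" if "b \<in> carrier Abar" for b
    using \<tau> that by (auto simp: iso_def hom_def)
  have p: "p \<in> hom A (A Mod C)" unfolding p_def by (rule C.r_coset_hom_Mod)
  have p_img: "p ` carrier A = carrier (A Mod C)" unfolding p_def by (rule image_r_coset)
  have p_ker: "kernel A (A Mod C) p = C" unfolding p_def by (rule kernel_r_coset) fact
  have q: "q \<in> hom Abar Q" unfolding q_def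
    using \<tau> p \<psi> by (intro hom_compose) (auto simp: iso_def)
  have q_img: "q ` carrier Abar = carrier Q"
    using \<tau> \<psi> p_img unfolding q_def image_comp[symmetric] by (simp add: iso_def bij_betw_def)
  have f: "(\<lambda>a. (fp_inl (A Mod C) Q (p a), a)) \<in> hom A (P \<times>\<times> A)"
    using hom_compose[OF p fp_inl_hom[of "A Mod C" Q, folded P_def]]
    by (simp add: hom_def Pi_iff)
  have g: "(\<lambda>b. (fp_inr (A Mod C) Q (q b), \<tau> b)) \<in> hom Abar (P \<times>\<times> A)"
    using hom_compose[OF q fp_inr_hom[of "A Mod C" Q, folded P_def]] \<tau>
    by (simp add: hom_def iso_def Pi_iff)
  obtain h where h: "h \<in> hom F (P \<times>\<times> A)"
      "\<And>a. a \<in> carrier A \<Longrightarrow> h (i a) = (fp_inl (A Mod C) Q (p a), a)"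
      "\<And>b. b \<in> carrier Abar \<Longrightarrow> h (j b) = (fp_inr (A Mod C) Q (q b), \<tau> b)"
    using free_product_lift[OF A.is_group B.is_group PA.is_group f g]
    unfolding F_def i_def j_def by blast
  interpret h: group_hom F "P \<times>\<times> A" h by unfold_locales (rule h)
  have R: "R \<subseteq> carrier F" using \<theta>_closed by (auto simp: R_def)
  have N: "N \<lhd> F" unfolding N_def using R by (intro normal_closure_normal) unfold_locales
  interpret N: normal N F by fact
  have p_C: "p c = \<one>\<^bsub>A Mod C\<^esub>" if "c \<in> C" for c using p_ker that by (auto simp: kernel_def)
  have inl_one: "fp_inl (A Mod C) Q \<one>\<^bsub>A Mod C\<^esub> = \<one>\<^bsub>P\<^esub>"
    using hom_one[OF fp_inl_hom AC.is_group P.is_group[unfolded P_def]] by (simp add: P_def)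
  have inr_one: "fp_inr (A Mod C) Q \<one>\<^bsub>Q\<^esub> = \<one>\<^bsub>P\<^esub>"
    using hom_one[OF fp_inr_hom Q.is_group P.is_group[unfolded P_def]] by (simp add: P_def)
  have \<psi>_one: "\<psi> \<one>\<^bsub>A Mod C\<^esub> = \<one>\<^bsub>Q\<^esub>"
    using hom_one[of \<psi>, OF _ AC.is_group Q.is_group] \<psi> by (simp add: iso_def)
  have h_R: "h x = \<one>\<^bsub>P \<times>\<times> A\<^esub>" if x: "x \<in> R" for x
  proof -
    obtain c where c: "c \<in> C" "x = i c \<otimes>\<^bsub>F\<^esub> inv\<^bsub>F\<^esub> (j (\<theta> c))" using x unfolding R_def by blast
    have cA: "c \<in> carrier A" using c by simp
    have "q (\<theta> c) = \<one>\<^bsub>Q\<^esub>" by (simp only: q_def o_apply \<tau>_\<theta>[OF cA] p_C[OF c(1)] \<psi>_one)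
    then have "h (j (\<theta> c)) = h (i c)"
      by (simp only: h(2)[OF cA] h(3)[OF \<theta>_closed[OF cA]] p_C[OF c(1)] \<tau>_\<theta>[OF cA] inl_one inr_one)
    then show ?thesis
      by (simp only: c(2) h.hom_mult h.hom_inv F.inv_closed i.hom_closed j.hom_closed cA
          \<theta>_closed[OF cA] h.hom_closed PA.r_inv)
  qed
  have j_\<theta>: "j (\<theta> c) \<in> N <#>\<^bsub>F\<^esub> i ` C" if "c \<in> C" for c
  proof -
    have "i c \<otimes>\<^bsub>F\<^esub> inv\<^bsub>F\<^esub> (j (\<theta> c)) \<in> N"
      using normal_closure_subset[of R F] that by (auto simp: R_def N_def)
    then have "inv\<^bsub>F\<^esub> (i c \<otimes>\<^bsub>F\<^esub> inv\<^bsub>F\<^esub> (j (\<theta> c))) \<in> N" by simp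
    \<comment> \<open>Modulo \<open>N\<close> the two copies of \<open>c\<close> agree; the
      discrepancy is the inverse of the relator of \<open>c\<close>.\<close>
    moreover have "j (\<theta> c) = inv\<^bsub>F\<^esub> (i c \<otimes>\<^bsub>F\<^esub> inv\<^bsub>F\<^esub> (j (\<theta> c))) \<otimes>\<^bsub>F\<^esub> i c"
      using that \<theta>_closed by (simp add: F.inv_mult_group F.m_assoc)
    ultimately show ?thesis using that by (metis set_multI imageI)
  qed
  have conj: "j b \<otimes>\<^bsub>F\<^esub> i c \<otimes>\<^bsub>F\<^esub> inv\<^bsub>F\<^esub> (j b) \<in> N <#>\<^bsub>F\<^esub> i ` C"
    if b: "b \<in> carrier Abar" and c: "c \<in> C" for b c
  proof -
    define r where "r = i c \<otimes>\<^bsub>F\<^esub> inv\<^bsub>F\<^esub> (j (\<theta> c))"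
    have r: "r \<in> N"
      using normal_closure_subset[of R F] c by (auto simp: R_def N_def r_def)
    \<comment> \<open>Writing \<open>i c\<close> as \<open>r * j (\<theta> c)\<close> splits its
      conjugate by \<open>j b\<close> into a conjugate of \<open>r\<close>, which stays in
      \<open>N\<close>, and a conjugation inside the copy of \<open>A\<close>. The latter is
      \<open>j (\<theta> d)\<close>, and \<open>d\<close> is in \<open>C\<close> by
      normality.\<close>
    define d where "d = \<tau> b \<otimes>\<^bsub>A\<^esub> c \<otimes>\<^bsub>A\<^esub> inv\<^bsub>A\<^esub> (\<tau> b)"
    have d: "d \<in> C" unfolding d_def using C.inv_op_closed2 \<tau>_closed b c by blast
    have "\<theta> d = b \<otimes>\<^bsub>Abar\<^esub> \<theta> c \<otimes>\<^bsub>Abar\<^esub> inv\<^bsub>Abar\<^esub> b"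
      using b c \<tau>_closed by (simp add: d_def \<theta>_\<tau>)
    then have jd: "j (\<theta> d) = j b \<otimes>\<^bsub>F\<^esub> j (\<theta> c) \<otimes>\<^bsub>F\<^esub> inv\<^bsub>F\<^esub> (j b)"
      using b c \<theta>_closed by simp
    obtain n c' where n: "n \<in> N" "c' \<in> C" "j (\<theta> d) = n \<otimes>\<^bsub>F\<^esub> i c'"
      using j_\<theta>[OF d] unfolding set_mult_def by auto
    have "j b \<otimes>\<^bsub>F\<^esub> i c \<otimes>\<^bsub>F\<^esub> inv\<^bsub>F\<^esub> (j b)
        = (j b \<otimes>\<^bsub>F\<^esub> r \<otimes>\<^bsub>F\<^esub> inv\<^bsub>F\<^esub> (j b)) \<otimes>\<^bsub>F\<^esub> j (\<theta> d)"
      unfolding jd r_def using b c \<theta>_closed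
      by (simp add: F.m_assoc F.m_inv_cancel)
    also have "\<dots> = (j b \<otimes>\<^bsub>F\<^esub> r \<otimes>\<^bsub>F\<^esub> inv\<^bsub>F\<^esub> (j b) \<otimes>\<^bsub>F\<^esub> n) \<otimes>\<^bsub>F\<^esub> i c'"
      using b r n by (simp add: F.m_assoc)
    finally show ?thesis
      using N.inv_op_closed2[OF j.hom_closed[OF b] r] n by (simp add: set_multI)
  qed
  have kerq: "j b \<in> N <#>\<^bsub>F\<^esub> i ` C" if b: "b \<in> carrier Abar" and "q b = \<one>\<^bsub>Q\<^esub>" for b
  proof -
    \<comment> \<open>Injectivity of \<open>\<psi>\<close> places \<open>\<tau> b\<close> in
      \<open>C\<close>, so \<open>b\<close> is \<open>\<theta>\<close> of an element of
      \<open>C\<close> and \<open>j_\<theta>\<close> applies.\<close>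
    have "\<psi> (p (\<tau> b)) = \<psi> \<one>\<^bsub>A Mod C\<^esub>" using that \<psi>_one by (simp add: q_def)
    moreover have "inj_on \<psi> (carrier (A Mod C))" using \<psi> by (simp add: iso_def bij_betw_def)
    ultimately have "p (\<tau> b) = \<one>\<^bsub>A Mod C\<^esub>"
      using hom_in_carrier[OF p \<tau>_closed[OF b]] AC.one_closed by (metis inj_onD)
    then have "\<tau> b \<in> C" using p_ker \<tau>_closed[OF b] by (auto simp: kernel_def)
    then show ?thesis using j_\<theta> \<theta>_\<tau>[OF b] by metis
  qed
  have "(\<lambda>X. the_elem (h ` X)) \<in> mon (F Mod N) (P \<times>\<times> A)"
    unfolding F_def P_def N_def
    by (rule mon_Mod_normal_closure[OF A.is_group B.is_group AC.is_group Q.is_group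
          p p_img p_ker q q_img, where h = h and R = R])
       (use h R h_R conj kerq in \<open>simp_all add: F_def P_def N_def i_def j_def\<close>)
  then show ?thesis
    unfolding group_double_def amalgamated_product_def
    by (auto simp: F_def P_def N_def R_def i_def j_def)
qed

section \<open>The embedding of the HNN extension\<close>

text \<open>The map sends \<open>a\<close> to (aC, a) and the stable letter s to (s, 1). A relator
  dies in the first component because \<open>c\<close> becomes trivial there, and in the second
  because s does.\<close>

lemma centralizing_HNN_mon:
  fixes A :: "('a, 'm) monoid_scheme"
  assumes "group A" "C \<lhd> A"
  shows "\<exists>f. f \<in> mon (centralizing_HNN A C) (free_product (A Mod C) integer_group \<times>\<times> A)"
proof -
  interpret A: group A by fact
  interpret Z: group integer_group by simp
  interpret C: normal C A by fact
  interpret AC: group "A Mod C" by (rule C.factorgroup_is_group)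
  define F where "F = free_product A integer_group"
  define P where "P = free_product (A Mod C) integer_group"
  interpret F: group F unfolding F_def by (rule group_free_product) unfold_locales
  interpret P: group P unfolding P_def by (rule group_free_product) unfold_locales
  interpret PA: group "P \<times>\<times> A" by (rule DirProd_group) unfold_locales
  define i where "i = fp_inl A integer_group"
  define j where "j = fp_inr A integer_group"
  have i_hom: "i \<in> hom A F" unfolding i_def F_def by (rule fp_inl_hom)
  have j_hom: "j \<in> hom integer_group F" unfolding j_def F_def by (rule fp_inr_hom)
  interpret i: group_hom A F i by unfold_locales (rule i_hom)
  interpret j: group_hom integer_group F j by unfold_locales (rule j_hom)
  have j_closed: "j n \<in> carrier F" for n using j.hom_closed by simp
  define R where "R = {inv\<^bsub>F\<^esub> (j 1) \<otimes>\<^bsub>F\<^esub> i c \<otimes>\<^bsub>F\<^esub> j 1 \<otimes>\<^bsub>F\<^esub> inv\<^bsub>F\<^esub> (i c) | c. c \<in> C}"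
  define N where "N = normal_closure F R"
  define p where "p = (#>\<^bsub>A\<^esub>) C"
  have p: "p \<in> hom A (A Mod C)" unfolding p_def by (rule C.r_coset_hom_Mod)
  have p_img: "p ` carrier A = carrier (A Mod C)" unfolding p_def by (rule image_r_coset)
  have p_ker: "kernel A (A Mod C) p = C" unfolding p_def by (rule kernel_r_coset) fact
  have f: "(\<lambda>a. (fp_inl (A Mod C) integer_group (p a), a)) \<in> hom A (P \<times>\<times> A)"
    using hom_compose[OF p fp_inl_hom[of "A Mod C" integer_group, folded P_def]]
    by (simp add: hom_def Pi_iff)
  have g: "(\<lambda>n. (fp_inr (A Mod C) integer_group n, \<one>\<^bsub>A\<^esub>)) \<in> hom integer_group (P \<times>\<times> A)"
    using fp_inr_hom[of "A Mod C" integer_group, folded P_def]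
    by (simp add: hom_def Pi_iff)
  obtain h where h: "h \<in> hom F (P \<times>\<times> A)"
      "\<And>a. a \<in> carrier A \<Longrightarrow> h (i a) = (fp_inl (A Mod C) integer_group (p a), a)"
      "\<And>n. h (j n) = (fp_inr (A Mod C) integer_group n, \<one>\<^bsub>A\<^esub>)"
    using free_product_lift[OF A.is_group Z.is_group PA.is_group f g]
    unfolding F_def i_def j_def by auto
  interpret h: group_hom F "P \<times>\<times> A" h by unfold_locales (rule h)
  have R: "R \<subseteq> carrier F" using j_closed by (auto simp: R_def)
  have N: "N \<lhd> F" unfolding N_def using R by (intro normal_closure_normal) unfold_locales
  interpret N: normal N F by fact
  interpret FN: group "F Mod N" by (rule N.factorgroup_is_group)
  have p_C: "p c = \<one>\<^bsub>A Mod C\<^esub>" if "c \<in> C" for c using p_ker that by (auto simp: kernel_def)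
  have inl_one: "fp_inl (A Mod C) integer_group \<one>\<^bsub>A Mod C\<^esub> = \<one>\<^bsub>P\<^esub>"
    using hom_one[OF fp_inl_hom AC.is_group P.is_group[unfolded P_def]] by (simp add: P_def)
  have h_R: "h x = \<one>\<^bsub>P \<times>\<times> A\<^esub>" if x: "x \<in> R" for x
  proof -
    obtain c where c: "c \<in> C" "x = inv\<^bsub>F\<^esub> (j 1) \<otimes>\<^bsub>F\<^esub> i c \<otimes>\<^bsub>F\<^esub> j 1 \<otimes>\<^bsub>F\<^esub> inv\<^bsub>F\<^esub> (i c)"
      using x unfolding R_def by blast
    have cA: "c \<in> carrier A" using c by simp
    have z: "fp_inr (A Mod C) integer_group 1 \<in> carrier P"
      unfolding P_def by (rule hom_in_carrier[OF fp_inr_hom]) simp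
    have hc: "h (i c) = (\<one>\<^bsub>P\<^esub>, c)" by (simp only: h(2)[OF cA] p_C[OF c(1)] inl_one)
    have "h x = inv\<^bsub>P \<times>\<times> A\<^esub> h (j 1) \<otimes>\<^bsub>P \<times>\<times> A\<^esub> h (i c)
        \<otimes>\<^bsub>P \<times>\<times> A\<^esub> h (j 1) \<otimes>\<^bsub>P \<times>\<times> A\<^esub> inv\<^bsub>P \<times>\<times> A\<^esub> h (i c)"
      by (simp only: c(2) h.hom_mult h.hom_inv F.inv_closed F.m_closed i.hom_closed j_closed cA)
    then show ?thesis using z cA
      by (simp add: hc h(3) inv_DirProd P.is_group A.is_group)
  qed
  \<comment> \<open>From here on the unit and product of \<open>F Mod N\<close> must stay folded, so
    that the rules for groups and homomorphisms apply to them instead of facts on sets of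
    cosets.\<close>
  note one_FactGroup [simp del] mult_FactGroup [simp del]
  define \<pi> where "\<pi> = (#>\<^bsub>F\<^esub>) N"
  have \<pi>: "\<pi> \<in> hom F (F Mod N)" unfolding \<pi>_def by (rule N.r_coset_hom_Mod)
  interpret \<pi>: group_hom F "F Mod N" \<pi> by unfold_locales (rule \<pi>)
  have \<pi>_eqD: "x \<otimes>\<^bsub>F\<^esub> inv\<^bsub>F\<^esub> y \<in> N" if "\<pi> x = \<pi> y" "x \<in> carrier F" "y \<in> carrier F" for x y
  proof -
    have "\<pi> (x \<otimes>\<^bsub>F\<^esub> inv\<^bsub>F\<^esub> y) = \<one>\<^bsub>F Mod N\<^esub>" using that by simp
    then have "x \<otimes>\<^bsub>F\<^esub> inv\<^bsub>F\<^esub> y \<in> kernel F (F Mod N) \<pi>" using that by (simp add: kernel_def)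
    then show ?thesis using kernel_r_coset[OF N] by (simp add: \<pi>_def)
  qed
  have \<pi>_N: "\<pi> x = \<one>\<^bsub>F Mod N\<^esub>" if "x \<in> N" for x
    using that kernel_r_coset[OF N] by (auto simp: \<pi>_def kernel_def)
  have comm1: "\<pi> (i c) \<otimes>\<^bsub>F Mod N\<^esub> \<pi> (j 1) = \<pi> (j 1) \<otimes>\<^bsub>F Mod N\<^esub> \<pi> (i c)" if c: "c \<in> C" for c
  proof -
    have "inv\<^bsub>F\<^esub> (j 1) \<otimes>\<^bsub>F\<^esub> i c \<otimes>\<^bsub>F\<^esub> j 1 \<otimes>\<^bsub>F\<^esub> inv\<^bsub>F\<^esub> (i c) \<in> N"
      using normal_closure_subset[of R F] c by (auto simp: R_def N_def)
    from \<pi>_N[OF this] show ?thesis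
      using c j_closed by (intro FN.commute_if_commutator_one) simp_all
  qed
  have conj: "j n \<otimes>\<^bsub>F\<^esub> i c \<otimes>\<^bsub>F\<^esub> inv\<^bsub>F\<^esub> (j n) \<in> N <#>\<^bsub>F\<^esub> i ` C" if c: "c \<in> C" for n c
  proof -
    \<comment> \<open>The integer \<open>n\<close> is the \<open>n\<close>-th power of the generator
      1 of \<open>integer_group\<close>.\<close>
    have pow: "j n = j 1 [^]\<^bsub>F\<^esub> n"
      using j.hom_int_pow[of 1 n] by simp
    \<comment> \<open>The relators only say that s commutes with \<open>C\<close> modulo
      \<open>N\<close>; the powers follow in the quotient.\<close>
    have "\<pi> (j n) \<otimes>\<^bsub>F Mod N\<^esub> \<pi> (i c) = \<pi> (i c) \<otimes>\<^bsub>F Mod N\<^esub> \<pi> (j n)"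
      unfolding pow \<pi>.hom_int_pow[OF j_closed]
      using c j_closed comm1[OF c] by (intro FN.int_pow_commute) auto
    then have "\<pi> (j n \<otimes>\<^bsub>F\<^esub> i c) = \<pi> (i c \<otimes>\<^bsub>F\<^esub> j n)"
      using c j_closed by simp
    then have "(j n \<otimes>\<^bsub>F\<^esub> i c) \<otimes>\<^bsub>F\<^esub> inv\<^bsub>F\<^esub> (i c \<otimes>\<^bsub>F\<^esub> j n) \<in> N"
      using c j_closed by (intro \<pi>_eqD) auto
    \<comment> \<open>The conjugate is the commutator of \<open>j n\<close> and \<open>i c\<close>,
      which lies in \<open>N\<close>, times \<open>i c\<close>.\<close>
    moreover have "j n \<otimes>\<^bsub>F\<^esub> i c \<otimes>\<^bsub>F\<^esub> inv\<^bsub>F\<^esub> (j n)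
      = (j n \<otimes>\<^bsub>F\<^esub> i c) \<otimes>\<^bsub>F\<^esub> inv\<^bsub>F\<^esub> (i c \<otimes>\<^bsub>F\<^esub> j n) \<otimes>\<^bsub>F\<^esub> i c"
      using c j_closed by (simp add: F.inv_mult_group F.m_assoc)
    ultimately show ?thesis using c by (simp only: set_multI imageI)
  qed
  have kerq: "j n \<in> N <#>\<^bsub>F\<^esub> i ` C" if "n = 0" for n
  proof -
    have "j n = i \<one>\<^bsub>A\<^esub>" using that j.hom_one by simp
    then have "j n \<in> i ` C" using C.one_closed by (simp only: imageI)
    then show ?thesis
      using j_closed by (intro F.mem_set_mult_right N.subgroup_axioms)
  qed
  \<comment> \<open>The infinite cyclic factor is kept as it is, so \<open>q\<close> is the identity
    and its kernel condition reduces to \<open>n = 0\<close>.\<close>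
  have "(\<lambda>X. the_elem (h ` X)) \<in> mon (F Mod N) (P \<times>\<times> A)"
    unfolding F_def P_def N_def
    by (rule mon_Mod_normal_closure[OF A.is_group Z.is_group AC.is_group Z.is_group
          p p_img p_ker, where h = h and R = R and q = id])
       (use h R h_R conj kerq in \<open>simp_all add: F_def P_def N_def i_def j_def hom_def\<close>)
  then show ?thesis
    unfolding centralizing_HNN_def stable_letter_def Let_def
    by (auto simp: F_def P_def N_def R_def i_def j_def)
qed

text \<open>Copies are given up to isomorphism: \<open>\<theta>\<close> presents \<open>Abar\<close>
  as a copy of \<open>A\<close>, and \<open>\<psi>\<close> presents \<open>Q\<close> as a copy of
  A/C. An embedding is an injective homomorphism, that is, an element of \<open>mon\<close>.\<close>

theorem theorem1:
  fixes A :: "('a, 'm) monoid_scheme" and C :: "'a set"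
    and Abar :: "('b, 'n) monoid_scheme" and \<theta> :: "'a \<Rightarrow> 'b"
    and Q :: "('q, 'k) monoid_scheme" and \<psi> :: "'a set \<Rightarrow> 'q"
  assumes "group A" and "C \<lhd> A"
    and "group Abar" and "\<theta> \<in> iso A Abar"
    and "group Q" and "\<psi> \<in> iso (A Mod C) Q"
  shows "(\<exists>f. f \<in> mon (group_double A C \<theta> Abar) (free_product (A Mod C) Q \<times>\<times> A))
       \<and> (\<exists>f. f \<in> mon (centralizing_HNN A C) (free_product (A Mod C) integer_group \<times>\<times> A))"
  using group_double_mon[OF assms] centralizing_HNN_mon[OF assms(1,2)] by blast

end
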